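(* Let $G$ be a graph on $n\ge 2$ vertices with $m$ edges. Then $G$ contains a subgraph on at least $c\,\frac{m}{n\log n}$ vertices that is globally rigid in $\mathbb{R}$, where $c=2\log 2$.
   Context: A graph $H=(V,E)$ is globally rigid in $\mathbb{R}$ if for every pair of injective maps $f,g:V\to\mathbb{R}$ satisfying $|f(x)-f(y)|=|g(x)-g(y)|$ for every edge $xy\in E$, we also have $|f(x)-f(y)|=|g(x)-g(y)|$ for every pair $x,y\in V$. Here $\log$ denotes the natural logarithm. *)

theory Defs
  imports Complex_Main
begin

text \<open>A graph is given by its vertex set \<open>V\<close> and its set \<open>E\<close> of edges, an edge being an
  unordered pair of distinct vertices, encoded as a two-element set.\<close>

definition simple_graph :: "'a set \<Rightarrow> 'a set set \<Rightarrow> bool" where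
  "simple_graph V E \<longleftrightarrow> finite V \<and> (\<forall>e\<in>E. e \<subseteq> V \<and> card e = 2)"

definition is_subgraph :: "'a set \<Rightarrow> 'a set set \<Rightarrow> 'a set \<Rightarrow> 'a set set \<Rightarrow> bool" where
  "is_subgraph W F V E \<longleftrightarrow> simple_graph W F \<and> W \<subseteq> V \<and> F \<subseteq> E"

text \<open>Maps \<open>V \<rightarrow> \<real>\<close> are represented by total functions, of which only the values on \<open>V\<close> matter.\<close>

definition globally_rigid :: "'a set \<Rightarrow> 'a set set \<Rightarrow> bool" where
  "globally_rigid V E \<longleftrightarrow>
    (\<forall>f g :: 'a \<Rightarrow> real.
       inj_on f V \<longrightarrow> inj_on g V \<longrightarrow>
       (\<forall>x\<in>V. \<forall>y\<in>V. {x, y} \<in> E \<longrightarrow> \<bar>f x - f y\<bar> = \<bar>g x - g y\<bar>) \<longrightarrow>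
       (\<forall>x\<in>V. \<forall>y\<in>V. \<bar>f x - f y\<bar> = \<bar>g x - g y\<bar>))"

end

theory Submission
  imports Defs
begin

text \<open>If \<open>f\<close> and \<open>g\<close> witness that a graph is not globally rigid, put the vertex \<open>v\<close> at the point
  \<open>(f v - g v, f v + g v)\<close> of the plane. Distinct vertices get distinct points, every edge lies in a
  row or in a column, and no row or column contains all vertices. If no globally rigid subgraph has
  more than \<open>s\<close> vertices, then induction on the rows and columns bounds the number of edges by
  \<open>(s / 2) n log\<^sub>2 n\<close>; the induction step is the subadditivity of entropy for the two
  coordinates of a uniformly random vertex.\<close>

text \<open>Indexed by a vertex and not by a value of \<open>a\<close>, so that a sum over
  \<open>V\<close> weights each fibre by its size, as an expectation over a uniformly random vertex
  requires.\<close>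

definition fibre :: "('a \<Rightarrow> 'b) \<Rightarrow> 'a set \<Rightarrow> 'a \<Rightarrow> 'a set" where
  "fibre a V v = {x\<in>V. a x = a v}"

text \<open>The sum counts triples \<open>(v, x, y)\<close> with \<open>x\<close> in the row and
  \<open>y\<close> in the column of \<open>v\<close>. The pair \<open>(x, y)\<close> fixes both
  coordinates of \<open>v\<close>, hence \<open>v\<close> itself.\<close>

lemma sum_card_fibres_le:
  assumes "finite V" and inj: "inj_on (\<lambda>v. (a v, b v)) V"
  shows "(\<Sum>v\<in>V. card (fibre a V v) * card (fibre b V v)) \<le> card V * card V"
proof -
  let ?T = "SIGMA v:V. fibre a V v \<times> fibre b V v"
  have fin: "finite (fibre a V v)" "finite (fibre b V v)" for v
    using assms(1) by (auto simp: fibre_def)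
  have "(\<Sum>v\<in>V. card (fibre a V v) * card (fibre b V v)) = card ?T"
    using assms(1) fin by (simp add: card_cartesian_product)
  also have "\<dots> \<le> card (V \<times> V)"
  proof (rule card_inj_on_le)
    show "inj_on snd ?T"
      using inj by (auto simp: inj_on_def fibre_def)
  qed (use assms(1) in \<open>auto simp: fibre_def\<close>)
  finally show ?thesis by (simp add: card_cartesian_product)
qed

text \<open>For a uniformly random vertex, \<open>a\<close> has entropy \<open>ln n\<close> minus
  the average of \<open>ln (card (fibre a V v))\<close>, likewise \<open>b\<close>, while the pair
  has entropy \<open>ln n\<close> by injectivity. Subadditivity, multiplied by \<open>n\<close>, is
  this inequality.\<close>

lemma sum_ln_card_fibres_le:
  assumes fin: "finite V" and inj: "inj_on (\<lambda>v. (a v, b v)) V"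
  shows "(\<Sum>v\<in>V. ln (real (card (fibre a V v)))) + (\<Sum>v\<in>V. ln (real (card (fibre b V v))))
    \<le> real (card V) * ln (real (card V))"
proof (cases "V = {}")
  case False
  define n where "n = real (card V)"
  have n: "n > 0" using False fin by (simp add: n_def card_gt_0_iff)
  let ?r = "\<lambda>v. real (card (fibre a V v))" and ?c = "\<lambda>v. real (card (fibre b V v))"
  have "ln (?r v) + ln (?c v) \<le> ln n + (?r v * ?c v / n - 1)" if "v \<in> V" for v
  proof -
    have "v \<in> fibre a V v" "v \<in> fibre b V v" using that by (auto simp: fibre_def)
    then have pos: "?r v > 0" "?c v > 0" using fin by (auto simp: card_gt_0_iff fibre_def)
    \<comment> \<open>Gibbs' inequality termwise: after summation the products over \<open>n\<close>
      contribute at most \<open>n\<close>, which the terms \<open>- 1\<close> cancel.\<close>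
    have "ln (?r v * ?c v / n) \<le> ?r v * ?c v / n - 1"
      using pos n by (intro ln_le_minus_one) simp
    then show ?thesis using pos n by (simp add: ln_div ln_mult)
  qed
  then have "(\<Sum>v\<in>V. ln (?r v) + ln (?c v)) \<le> (\<Sum>v\<in>V. ln n + (?r v * ?c v / n - 1))"
    by (rule sum_mono)
  also have "\<dots> = n * ln n + (\<Sum>v\<in>V. ?r v * ?c v) / n - n"
    by (simp add: sum.distrib sum_subtractf sum_divide_distrib n_def)
  also have "\<dots> \<le> n * ln n + n * n / n - n"
  proof -
    have "(\<Sum>v\<in>V. ?r v * ?c v) \<le> n * n"
      using of_nat_mono[OF sum_card_fibres_le[OF assms], where 'a = real] by (simp add: n_def)
    then show ?thesis using n by (simp add: pos_divide_le_eq)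
  qed
  finally show ?thesis using n by (simp add: sum.distrib n_def)
qed simp

text \<open>A fibre \<open>S\<close> contributes at most \<open>k * (card S * ln (card S))\<close>,
  which is \<open>k * ln (card S)\<close> spread over each of its vertices; so the sum over fibres
  turns into a sum over vertices.\<close>

lemma card_edges_in_fibres_le:
  assumes fin: "finite V"
    and bound: "\<And>v. v \<in> V \<Longrightarrow> real (card {e\<in>E. e \<subseteq> fibre a V v})
      \<le> k * (real (card (fibre a V v)) * ln (real (card (fibre a V v))))"
  shows "real (card {e\<in>E. \<exists>v\<in>V. e \<subseteq> fibre a V v})
    \<le> k * (\<Sum>v\<in>V. ln (real (card (fibre a V v))))"
proof -
  let ?S = "\<lambda>t. {x\<in>V. a x = t}"
  have "{e\<in>E. \<exists>v\<in>V. e \<subseteq> fibre a V v} = (\<Union>t\<in>a ` V. {e\<in>E. e \<subseteq> ?S t})"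
    by (auto simp: fibre_def)
  then have "real (card {e\<in>E. \<exists>v\<in>V. e \<subseteq> fibre a V v})
      \<le> (\<Sum>t\<in>a ` V. real (card {e\<in>E. e \<subseteq> ?S t}))"
    using card_UN_le[of "a ` V" "\<lambda>t. {e\<in>E. e \<subseteq> ?S t}"] fin
    by (simp flip: of_nat_sum)
  also have "\<dots> \<le> (\<Sum>t\<in>a ` V. k * (real (card (?S t)) * ln (real (card (?S t)))))"
    using bound by (intro sum_mono) (auto simp: fibre_def)
  also have "\<dots> = k * (\<Sum>t\<in>a ` V. \<Sum>v\<in>?S t. ln (real (card (fibre a V v))))"
    by (simp add: sum_distrib_left fibre_def)
  also have "\<dots> = k * (\<Sum>v\<in>V. ln (real (card (fibre a V v))))"
    using sum.image_gen[OF fin, of "\<lambda>v. ln (real (card (fibre a V v)))" a] by simp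
  finally show ?thesis .
qed

text \<open>Equal distances mean that the differences of \<open>f\<close> and of \<open>g\<close>
  agree up to sign; one sign makes \<open>f - g\<close> agree at the two ends, the other
  \<open>f + g\<close>. The pair whose distance changes therefore differs in both coordinates and
  lies in no common fibre.\<close>

lemma not_globally_rigidE:
  assumes "\<not> globally_rigid V E" and "simple_graph V E"
  obtains a b :: "'a \<Rightarrow> real" where
    "inj_on (\<lambda>v. (a v, b v)) V"
    "\<And>e. e \<in> E \<Longrightarrow> (\<exists>v\<in>V. e \<subseteq> fibre a V v) \<or> (\<exists>v\<in>V. e \<subseteq> fibre b V v)"
    "\<And>v. fibre a V v \<noteq> V" "\<And>v. fibre b V v \<noteq> V"
proof -
  obtain f g :: "'a \<Rightarrow> real" and x y where fg: "inj_on f V"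
      "\<And>x y. x \<in> V \<Longrightarrow> y \<in> V \<Longrightarrow> {x, y} \<in> E \<Longrightarrow> \<bar>f x - f y\<bar> = \<bar>g x - g y\<bar>"
    and xy: "x \<in> V" "y \<in> V" "\<bar>f x - f y\<bar> \<noteq> \<bar>g x - g y\<bar>"
    using assms(1) unfolding globally_rigid_def by blast
  define a b where "a = (\<lambda>v. f v - g v)" and "b = (\<lambda>v. f v + g v)"
  show thesis
  proof
    show "inj_on (\<lambda>v. (a v, b v)) V"
      using fg(1) by (auto simp: inj_on_def a_def b_def)
  next
    fix e assume e: "e \<in> E"
    then obtain u w where uw: "e = {u, w}" "u \<in> V" "w \<in> V"
      using assms(2) by (auto simp: simple_graph_def card_2_iff)
    then have "\<bar>f u - f w\<bar> = \<bar>g u - g w\<bar>" using fg(2) e by auto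
    then have "a w = a u \<or> b w = b u" by (auto simp: a_def b_def abs_if split: if_splits)
    then show "(\<exists>v\<in>V. e \<subseteq> fibre a V v) \<or> (\<exists>v\<in>V. e \<subseteq> fibre b V v)"
      using uw by (auto simp: fibre_def)
  next
    fix v
    have "\<not> (a x = a v \<and> a y = a v)" "\<not> (b x = b v \<and> b y = b v)"
      using xy(3) by (auto simp: a_def b_def abs_if split: if_splits)
    then show "fibre a V v \<noteq> V" "fibre b V v \<noteq> V"
      using xy(1,2) by (auto simp: fibre_def)
  qed
qed

lemma minus_one_times_ln2_le:
  assumes "n \<ge> 1"
  shows "(real n - 1) * ln 2 \<le> real n * ln (real n)"
proof (cases "n = 1")
  case False
  then have "n \<ge> 2" using assms by simp
  then show ?thesis by (intro mult_mono) auto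
qed simp

lemma card_edges_le_choose:
  assumes "simple_graph V E"
  shows "card E \<le> card V choose 2"
proof -
  have "E \<subseteq> {e. e \<subseteq> V \<and> card e = 2}" and "finite V"
    using assms by (auto simp: simple_graph_def)
  then show ?thesis
    using card_mono[of "{e. e \<subseteq> V \<and> card e = 2}" E] n_subsets[of V 2] by simp
qed

text \<open>The bound \<open>s\<close> passes to subgraphs, so it stays fixed in the induction on
  the number of vertices. A globally rigid graph has at most \<open>s\<close> vertices, and counting
  all pairs suffices; any other graph splits into proper rows and columns.\<close>

lemma card_edges_le_entropy:
  assumes "simple_graph V E"
    and "\<And>W F. is_subgraph W F V E \<Longrightarrow> globally_rigid W F \<Longrightarrow> card W \<le> s"
  shows "real (card E) \<le> real s / (2 * ln 2) * (real (card V) * ln (real (card V)))"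
  using assms
proof (induction "card V" arbitrary: V E rule: less_induct)
  case less
  have fin: "finite V" using less.prems(1) by (simp add: simple_graph_def)
  define k where "k = real s / (2 * ln 2)"
  have k: "k \<ge> 0" by (simp add: k_def)
  show ?case
  proof (cases "globally_rigid V E")
    case True
    define n where "n = card V"
    have "n \<le> s"
      using less.prems True by (auto simp: is_subgraph_def n_def)
    have E: "real (card E) \<le> real n * (real n - 1) / 2"
    proof -
      have "real (card E) \<le> real (n choose 2)"
        using card_edges_le_choose[OF less.prems(1)] by (simp add: n_def)
      also have "\<dots> = real n * (real n - 1) / 2"
        by (cases n) (simp_all add: choose_two real_of_nat_div algebra_simps)
      finally show ?thesis .
    qed
    show ?thesis
    proof (cases "n = 0")
      case False
      have "real (card E) * (2 * ln 2) \<le> real n * (real n - 1) / 2 * (2 * ln 2)"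
        using E by (intro mult_right_mono) auto
      also have "\<dots> = real n * ((real n - 1) * ln 2)" by simp
      \<comment> \<open>One factor \<open>n\<close> is bounded by \<open>s\<close>, the other factor
        gains the logarithm.\<close>
      also have "\<dots> \<le> real s * (real n * ln (real n))"
      proof (rule mult_mono)
        show "(real n - 1) * ln 2 \<le> real n * ln (real n)"
          using False by (intro minus_one_times_ln2_le) simp
        show "0 \<le> (real n - 1) * ln 2"
          using False by (intro mult_nonneg_nonneg) auto
      qed (use \<open>n \<le> s\<close> in auto)
      finally show ?thesis by (simp add: n_def field_simps)
    qed (use E in \<open>simp add: n_def\<close>)
  next
    case False
    obtain a b :: "'a \<Rightarrow> real" where inj: "inj_on (\<lambda>v. (a v, b v)) V"
      and edge: "\<And>e. e \<in> E \<Longrightarrow> (\<exists>v\<in>V. e \<subseteq> fibre a V v) \<or> (\<exists>v\<in>V. e \<subseteq> fibre b V v)"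
      and proper: "\<And>v. fibre a V v \<noteq> V" "\<And>v. fibre b V v \<noteq> V"
      using not_globally_rigidE[OF False less.prems(1)] by blast
    \<comment> \<open>Stated for any coordinate \<open>c\<close> with proper fibres, to serve rows
      and columns alike.\<close>
    have IH: "real (card {e\<in>E. e \<subseteq> fibre c V v})
        \<le> k * (real (card (fibre c V v)) * ln (real (card (fibre c V v))))"
      if "\<And>v. fibre c V v \<noteq> V" for c :: "'a \<Rightarrow> real" and v
      unfolding k_def
    proof (rule less.hyps)
      have sub: "fibre c V v \<subset> V" using that by (auto simp: fibre_def)
      then show "card (fibre c V v) < card V" using fin by (simp add: psubset_card_mono)
      show "simple_graph (fibre c V v) {e\<in>E. e \<subseteq> fibre c V v}"
        using less.prems(1) sub by (auto simp: simple_graph_def dest: finite_subset)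
      show "card W \<le> s"
        if "is_subgraph W F (fibre c V v) {e\<in>E. e \<subseteq> fibre c V v}" "globally_rigid W F" for W F
        using that sub by (intro less.prems(2)) (auto simp: is_subgraph_def)
    qed
    let ?E = "\<lambda>c. {e\<in>E. \<exists>v\<in>V. e \<subseteq> fibre c V v}"
    have "E = ?E a \<union> ?E b" using edge by blast
    then have "card E \<le> card (?E a) + card (?E b)" using card_Un_le[of "?E a" "?E b"] by simp
    then have "real (card E) \<le> real (card (?E a)) + real (card (?E b))" by linarith
    also have "\<dots> \<le> k * (\<Sum>v\<in>V. ln (real (card (fibre a V v))))
        + k * (\<Sum>v\<in>V. ln (real (card (fibre b V v))))"
      using proper by (intro add_mono card_edges_in_fibres_le fin IH)
    \<comment> \<open>Subadditivity of entropy recombines both parts with the same \<open>k\<close>,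
      so nothing is lost from level to level.\<close>
    also have "\<dots> \<le> k * (real (card V) * ln (real (card V)))"
      using mult_left_mono[OF sum_ln_card_fibres_le[OF fin inj] k] by (simp add: distrib_left)
    finally show ?thesis by (simp add: k_def)
  qed
qed

theorem theorem1p2:
  fixes V :: "'a set" and E :: "'a set set" and n m :: nat
  assumes "simple_graph V E"
    and "card V = n" and "n \<ge> 2"
    and "card E = m"
  shows "\<exists>W F. is_subgraph W F V E \<and> globally_rigid W F \<and>
           real (card W) \<ge> (2 * ln 2) * (real m / (real n * ln (real n)))"
proof -
  let ?P = "\<lambda>(W, F). is_subgraph W F V E \<and> globally_rigid W F"
  \<comment> \<open>The empty graph starts the search for a globally rigid subgraph with the most
    vertices; its order then serves as \<open>s\<close>.\<close>
  have "?P ({}, {})"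
    by (simp add: is_subgraph_def simple_graph_def globally_rigid_def)
  moreover have "\<forall>p. ?P p \<longrightarrow> card (fst p) < Suc (card V)"
    using assms(1) by (auto simp: is_subgraph_def simple_graph_def less_Suc_eq_le intro: card_mono)
  ultimately have "\<exists>p. ?P p \<and> (\<forall>q. ?P q \<longrightarrow> card (fst q) \<le> card (fst p))"
    by (rule ex_has_greatest_nat)
  then obtain p where p: "?P p" "\<forall>q. ?P q \<longrightarrow> card (fst q) \<le> card (fst p)"
    by (elim exE conjE)
  obtain W F where WF: "p = (W, F)" by (cases p)
  have "real m \<le> real (card W) / (2 * ln 2) * (real n * ln (real n))"
    using card_edges_le_entropy[OF assms(1), of "card W"] p assms(2,4) WF by auto
  moreover have "real n * ln (real n) > 0" using assms(3) by simp
  ultimately have "(2 * ln 2) * (real m / (real n * ln (real n))) \<le> real (card W)"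
    by (simp add: field_simps)
  then show ?thesis using p(1) WF by auto
qed

end
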